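(* Let $f$ be a $k$-ary function symbol. There exists a sentence $\psi\in\mathrm{FO}_{\mathbb{R}_{\geq0}}(\times,\mathrm{SUM})[\tau_0\cup\{\leq\}\cup\{f\}]$ for which there is no formula $\phi_\psi(v_1,\dots,v_k)\in\mathrm{FOPT}(\leq^\delta_{\mathrm{c}})[\tau_0]$ such that for every finite $\tau_0$-structure $\mathcal{A}_0$ and every nonempty probabilistic team $\mathbb{X}$ of $\mathcal{A}_0$ over $\{v_1,\dots,v_k\}$, \[ \mathcal{A}_0\models_{\mathbb{X}}\phi_\psi\iff(\mathcal{A}_0,(\mathbb{R}_{\geq0},\leq),\{f_{\mathbb{X}}\})\models\psi, \] where $f_{\mathbb{X}}\colon A_0^k\to\mathbb{R}_{\geq0}$ is given by $f_{\mathbb{X}}(s(v_1),\dots,s(v_k))=\mathbb{X}(s)$ for every assignment $s$.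
   Context: $\tau_0$ is a finite vocabulary of relation and constant symbols containing equality; $v_1,\dots,v_k$ are distinct variables. Probabilistic team semantics: for finite $D$, $X$ is the set of all $s\colon D\to A_0$; a probabilistic team is $\mathbb{X}\colon X\to\mathbb{R}_{\geq0}$, $\mathrm{supp}(\mathbb{X})=\{s\mid\mathbb{X}(s)\neq0\}$, nonempty iff the support is nonempty; $\mathbb{X}(a/x)(s)=\sum_{t\in X,\ t(a/x)=s}\mathbb{X}(t)$. Quantifier-free $\delta::=\lambda\mid\neg\delta\mid\delta\wedge\delta$ ($\lambda$ atomic); $\mathbb{X}[\delta]=\sum_{s\in X,\ \mathcal{A}_0\models_s\delta}\mathbb{X}(s)$. $\mathrm{FOPT}(\leq^\delta_{\mathrm{c}})$: $\phi::=\delta\mid(\delta|\delta)\leq(\delta|\delta)\mid\dot\sim\phi\mid\phi\wedge\phi\mid\phi\mathbin{\dot\vee}\phi\mid\exists^1x\phi\mid\forall^1x\phi$, with $\mathcal{A}_0\models_{\mathbb{X}}\delta$ iff $\mathcal{A}_0\models_s\delta$ for all $s\in\mathrm{supp}(\mathbb{X})$; $(\delta_0|\delta_1)\leq(\delta_2|\delta_3)$ iff $\mathbb{X}[\delta_0\wedge\delta_1]\mathbb{X}[\delta_3]\leq\mathbb{X}[\delta_2\wedge\delta_3]\mathbb{X}[\delta_1]$; $\dot\sim\phi$ iff $\mathcal{A}_0\not\models_{\mathbb{X}}\phi$ or $\mathrm{supp}(\mathbb{X})=\varnothing$; $\wedge$, $\dot\vee$ conjunction/disjunction of satisfaction; $\exists^1x\phi$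 iff $\mathcal{A}_0\models_{\mathbb{X}(a/x)}\phi$ for some $a\in A_0$; $\forall^1x\phi$ iff for all $a\in A_0$. Logic $\mathrm{FO}_{\mathbb{R}_{\geq0}}(\times,\mathrm{SUM})$ on structures $\mathcal{A}=(\mathcal{A}_0,(\mathbb{R}_{\geq0},\leq),\{f^{\mathcal{A}}\})$ ($\mathcal{A}_0$ finite $\tau_0$-structure, $f^{\mathcal{A}}\colon A_0^k\to\mathbb{R}_{\geq0}$): first-order variables range over $A_0$; $\gamma::=\lambda\mid\neg\gamma\mid\gamma\wedge\gamma\mid\gamma\vee\gamma$; numerical terms $i::=f(\bar y)\mid i\times i\mid\mathrm{SUM}_{\bar x}(i,\gamma)$ ($|\bar y|=k$); formulas $\phi::=\lambda\mid i\leq i\mid\neg\phi\mid\phi\wedge\phi\mid\phi\vee\phi\mid\exists x\phi\mid\forall x\phi$. Semantics: $[f(\bar y)]_s=f^{\mathcal{A}}(s(\bar y))$, $[i\times j]_s=[i]_s[j]_s$, $[\mathrm{SUM}_{\bar x}(i,\gamma)]_s=\sum_{\bar a\in A_0^{|\bar x|},\ \mathcal{A}_0\models_{s(\bar a/\bar x)}\gamma}[i]_{s(\bar a/\bar x)}$; $i\leq j$ iff $[i]_s\leq[j]_s$; the rest as in first-order logic. *)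

theory Defs
  imports Complex_Main
begin

section \<open>Vocabularies, structures and assignments\<close>

type_synonym var = nat

record ('r, 'c) vocabulary =
  rel_syms :: "'r set"
  arity :: "'r \<Rightarrow> nat"
  const_syms :: "'c set"

definition finite_vocabulary :: "('r, 'c) vocabulary \<Rightarrow> bool" where
  "finite_vocabulary \<tau> \<longleftrightarrow> finite (rel_syms \<tau>) \<and> finite (const_syms \<tau>)"

text \<open>The universe is an explicit subset of the type \<open>'a\<close>. When \<open>'a\<close> is infinite, e.g. \<open>nat\<close>,
  every finite structure has an isomorphic copy with universe in \<open>'a\<close>.\<close>

record ('r, 'c, 'a) struct =
  universe :: "'a set"
  rel_interp :: "'r \<Rightarrow> 'a list set"
  const_interp :: "'c \<Rightarrow> 'a"

definition tuples :: "'a set \<Rightarrow> nat \<Rightarrow> 'a list set" where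
  "tuples A n = {as. length as = n \<and> set as \<subseteq> A}"

definition finite_structure :: "('r, 'c) vocabulary \<Rightarrow> ('r, 'c, 'a) struct \<Rightarrow> bool" where
  "finite_structure \<tau> \<A> \<longleftrightarrow>
     finite (universe \<A>) \<and> universe \<A> \<noteq> {} \<and>
     (\<forall>R\<in>rel_syms \<tau>. rel_interp \<A> R \<subseteq> tuples (universe \<A>) (arity \<tau> R)) \<and>
     (\<forall>c\<in>const_syms \<tau>. const_interp \<A> c \<in> universe \<A>)"

text \<open>An assignment with domain \<open>D\<close> is a partial map whose domain is exactly \<open>D\<close>.\<close>

type_synonym 'a assignment = "var \<rightharpoonup> 'a"

definition assignments :: "('r, 'c, 'a) struct \<Rightarrow> var set \<Rightarrow> 'a assignment set" where
  "assignments \<A> D = {s. dom s = D \<and> ran s \<subseteq> universe \<A>}"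

section \<open>Atomic formulas\<close>

text \<open>Equality is a logical symbol, hence available over every vocabulary.\<close>

datatype 'c trm = Var var | Const 'c

datatype ('r, 'c) atom = Eq "'c trm" "'c trm" | Rel 'r "'c trm list"

fun trm_over :: "('r, 'c) vocabulary \<Rightarrow> 'c trm \<Rightarrow> bool" where
  "trm_over \<tau> (Var x) \<longleftrightarrow> True"
| "trm_over \<tau> (Const c) \<longleftrightarrow> c \<in> const_syms \<tau>"

fun atom_over :: "('r, 'c) vocabulary \<Rightarrow> ('r, 'c) atom \<Rightarrow> bool" where
  "atom_over \<tau> (Eq t u) \<longleftrightarrow> trm_over \<tau> t \<and> trm_over \<tau> u"
| "atom_over \<tau> (Rel R ts) \<longleftrightarrow>
     R \<in> rel_syms \<tau> \<and> length ts = arity \<tau> R \<and> (\<forall>t\<in>set ts. trm_over \<tau> t)"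

fun trm_vars :: "'c trm \<Rightarrow> var set" where
  "trm_vars (Var x) = {x}"
| "trm_vars (Const c) = {}"

fun atom_vars :: "('r, 'c) atom \<Rightarrow> var set" where
  "atom_vars (Eq t u) = trm_vars t \<union> trm_vars u"
| "atom_vars (Rel R ts) = (\<Union>t\<in>set ts. trm_vars t)"

text \<open>The value \<open>the (s x)\<close> is meaningful only for \<open>x \<in> dom s\<close>; the free-variable conditions
  imposed on formulas ensure that it is never used otherwise.\<close>

fun trm_val :: "('r, 'c, 'a) struct \<Rightarrow> 'a assignment \<Rightarrow> 'c trm \<Rightarrow> 'a" where
  "trm_val \<A> s (Var x) = the (s x)"
| "trm_val \<A> s (Const c) = const_interp \<A> c"

fun atom_sat :: "('r, 'c, 'a) struct \<Rightarrow> 'a assignment \<Rightarrow> ('r, 'c) atom \<Rightarrow> bool" where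
  "atom_sat \<A> s (Eq t u) \<longleftrightarrow> trm_val \<A> s t = trm_val \<A> s u"
| "atom_sat \<A> s (Rel R ts) \<longleftrightarrow> map (trm_val \<A> s) ts \<in> rel_interp \<A> R"

section \<open>Probabilistic teams\<close>

text \<open>A team over \<open>D\<close> is a weight function of which only the values on \<open>assignments \<A> D\<close>
  are relevant; \<open>prob_team\<close> therefore constrains only these.\<close>

type_synonym 'a team = "'a assignment \<Rightarrow> real"

definition prob_team :: "('r, 'c, 'a) struct \<Rightarrow> var set \<Rightarrow> 'a team \<Rightarrow> bool" where
  "prob_team \<A> D \<X> \<longleftrightarrow> (\<forall>s\<in>assignments \<A> D. 0 \<le> \<X> s)"

definition supp :: "('r, 'c, 'a) struct \<Rightarrow> var set \<Rightarrow> 'a team \<Rightarrow> 'a assignment set" where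
  "supp \<A> D \<X> = {s \<in> assignments \<A> D. \<X> s \<noteq> 0}"

text \<open>The team \<open>\<X>(a/x)\<close>, which has domain \<open>insert x D\<close>.\<close>

definition team_update ::
  "('r, 'c, 'a) struct \<Rightarrow> var set \<Rightarrow> 'a team \<Rightarrow> 'a \<Rightarrow> var \<Rightarrow> 'a team" where
  "team_update \<A> D \<X> a x = (\<lambda>s. \<Sum>t | t \<in> assignments \<A> D \<and> t(x \<mapsto> a) = s. \<X> t)"

section \<open>The logic FOPT with conditional probability inequalities\<close>

datatype ('r, 'c) qf =
    QAtom "('r, 'c) atom"
  | QNeg "('r, 'c) qf"
  | QAnd "('r, 'c) qf" "('r, 'c) qf"

fun qf_over :: "('r, 'c) vocabulary \<Rightarrow> ('r, 'c) qf \<Rightarrow> bool" where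
  "qf_over \<tau> (QAtom l) \<longleftrightarrow> atom_over \<tau> l"
| "qf_over \<tau> (QNeg d) \<longleftrightarrow> qf_over \<tau> d"
| "qf_over \<tau> (QAnd d e) \<longleftrightarrow> qf_over \<tau> d \<and> qf_over \<tau> e"

fun qf_vars :: "('r, 'c) qf \<Rightarrow> var set" where
  "qf_vars (QAtom l) = atom_vars l"
| "qf_vars (QNeg d) = qf_vars d"
| "qf_vars (QAnd d e) = qf_vars d \<union> qf_vars e"

fun qf_sat :: "('r, 'c, 'a) struct \<Rightarrow> 'a assignment \<Rightarrow> ('r, 'c) qf \<Rightarrow> bool" where
  "qf_sat \<A> s (QAtom l) \<longleftrightarrow> atom_sat \<A> s l"
| "qf_sat \<A> s (QNeg d) \<longleftrightarrow> \<not> qf_sat \<A> s d"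
| "qf_sat \<A> s (QAnd d e) \<longleftrightarrow> qf_sat \<A> s d \<and> qf_sat \<A> s e"

definition weight ::
  "('r, 'c, 'a) struct \<Rightarrow> var set \<Rightarrow> 'a team \<Rightarrow> ('r, 'c) qf \<Rightarrow> real" where
  "weight \<A> D \<X> d = (\<Sum>s | s \<in> assignments \<A> D \<and> qf_sat \<A> s d. \<X> s)"

text \<open>\<open>CondLe d0 d1 d2 d3\<close> stands for \<open>(d0|d1) \<le> (d2|d3)\<close>, and \<open>SNeg\<close> for the dotted
  negation.\<close>

datatype ('r, 'c) fopt =
    Flat "('r, 'c) qf"
  | CondLe "('r, 'c) qf" "('r, 'c) qf" "('r, 'c) qf" "('r, 'c) qf"
  | SNeg "('r, 'c) fopt"
  | PAnd "('r, 'c) fopt" "('r, 'c) fopt"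
  | POr "('r, 'c) fopt" "('r, 'c) fopt"
  | Ex1 var "('r, 'c) fopt"
  | All1 var "('r, 'c) fopt"

fun fopt_over :: "('r, 'c) vocabulary \<Rightarrow> ('r, 'c) fopt \<Rightarrow> bool" where
  "fopt_over \<tau> (Flat d) \<longleftrightarrow> qf_over \<tau> d"
| "fopt_over \<tau> (CondLe d0 d1 d2 d3) \<longleftrightarrow>
     qf_over \<tau> d0 \<and> qf_over \<tau> d1 \<and> qf_over \<tau> d2 \<and> qf_over \<tau> d3"
| "fopt_over \<tau> (SNeg p) \<longleftrightarrow> fopt_over \<tau> p"
| "fopt_over \<tau> (PAnd p q) \<longleftrightarrow> fopt_over \<tau> p \<and> fopt_over \<tau> q"
| "fopt_over \<tau> (POr p q) \<longleftrightarrow> fopt_over \<tau> p \<and> fopt_over \<tau> q"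
| "fopt_over \<tau> (Ex1 x p) \<longleftrightarrow> fopt_over \<tau> p"
| "fopt_over \<tau> (All1 x p) \<longleftrightarrow> fopt_over \<tau> p"

fun fopt_free :: "('r, 'c) fopt \<Rightarrow> var set" where
  "fopt_free (Flat d) = qf_vars d"
| "fopt_free (CondLe d0 d1 d2 d3) = qf_vars d0 \<union> qf_vars d1 \<union> qf_vars d2 \<union> qf_vars d3"
| "fopt_free (SNeg p) = fopt_free p"
| "fopt_free (PAnd p q) = fopt_free p \<union> fopt_free q"
| "fopt_free (POr p q) = fopt_free p \<union> fopt_free q"
| "fopt_free (Ex1 x p) = fopt_free p - {x}"
| "fopt_free (All1 x p) = fopt_free p - {x}"

fun fopt_sat ::
  "('r, 'c, 'a) struct \<Rightarrow> var set \<Rightarrow> 'a team \<Rightarrow> ('r, 'c) fopt \<Rightarrow> bool" where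
  "fopt_sat \<A> D \<X> (Flat d) \<longleftrightarrow> (\<forall>s\<in>supp \<A> D \<X>. qf_sat \<A> s d)"
| "fopt_sat \<A> D \<X> (CondLe d0 d1 d2 d3) \<longleftrightarrow>
     weight \<A> D \<X> (QAnd d0 d1) * weight \<A> D \<X> d3
       \<le> weight \<A> D \<X> (QAnd d2 d3) * weight \<A> D \<X> d1"
| "fopt_sat \<A> D \<X> (SNeg p) \<longleftrightarrow> \<not> fopt_sat \<A> D \<X> p \<or> supp \<A> D \<X> = {}"
| "fopt_sat \<A> D \<X> (PAnd p q) \<longleftrightarrow> fopt_sat \<A> D \<X> p \<and> fopt_sat \<A> D \<X> q"
| "fopt_sat \<A> D \<X> (POr p q) \<longleftrightarrow> fopt_sat \<A> D \<X> p \<or> fopt_sat \<A> D \<X> q"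
| "fopt_sat \<A> D \<X> (Ex1 x p) \<longleftrightarrow>
     (\<exists>a\<in>universe \<A>. fopt_sat \<A> (insert x D) (team_update \<A> D \<X> a x) p)"
| "fopt_sat \<A> D \<X> (All1 x p) \<longleftrightarrow>
     (\<forall>a\<in>universe \<A>. fopt_sat \<A> (insert x D) (team_update \<A> D \<X> a x) p)"

section \<open>First-order logic with products and sums over the nonnegative reals\<close>

datatype ('r, 'c) guard =
    GAtom "('r, 'c) atom"
  | GNeg "('r, 'c) guard"
  | GAnd "('r, 'c) guard" "('r, 'c) guard"
  | GOr "('r, 'c) guard" "('r, 'c) guard"

text \<open>There is a single function symbol, so \<open>App ys\<close> stands for \<open>f(ys)\<close>.\<close>

datatype ('r, 'c) numterm =
    App "var list"
  | Times "('r, 'c) numterm" "('r, 'c) numterm"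
  | Sum "var list" "('r, 'c) numterm" "('r, 'c) guard"

datatype ('r, 'c) fo =
    Atom "('r, 'c) atom"
  | NumLe "('r, 'c) numterm" "('r, 'c) numterm"
  | Neg "('r, 'c) fo"
  | And "('r, 'c) fo" "('r, 'c) fo"
  | Or "('r, 'c) fo" "('r, 'c) fo"
  | Ex var "('r, 'c) fo"
  | All var "('r, 'c) fo"

fun guard_over :: "('r, 'c) vocabulary \<Rightarrow> ('r, 'c) guard \<Rightarrow> bool" where
  "guard_over \<tau> (GAtom l) \<longleftrightarrow> atom_over \<tau> l"
| "guard_over \<tau> (GNeg g) \<longleftrightarrow> guard_over \<tau> g"
| "guard_over \<tau> (GAnd g h) \<longleftrightarrow> guard_over \<tau> g \<and> guard_over \<tau> h"
| "guard_over \<tau> (GOr g h) \<longleftrightarrow> guard_over \<tau> g \<and> guard_over \<tau> h"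

fun numterm_over :: "('r, 'c) vocabulary \<Rightarrow> nat \<Rightarrow> ('r, 'c) numterm \<Rightarrow> bool" where
  "numterm_over \<tau> k (App ys) \<longleftrightarrow> length ys = k"
| "numterm_over \<tau> k (Times i j) \<longleftrightarrow> numterm_over \<tau> k i \<and> numterm_over \<tau> k j"
| "numterm_over \<tau> k (Sum xs i g) \<longleftrightarrow> distinct xs \<and> numterm_over \<tau> k i \<and> guard_over \<tau> g"

text \<open>\<open>fo_over \<tau> k p\<close>: \<open>p\<close> is a formula over \<open>\<tau>\<close>, the order of the reals and a
  \<open>k\<close>-ary function symbol.\<close>

fun fo_over :: "('r, 'c) vocabulary \<Rightarrow> nat \<Rightarrow> ('r, 'c) fo \<Rightarrow> bool" where
  "fo_over \<tau> k (Atom l) \<longleftrightarrow> atom_over \<tau> l"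
| "fo_over \<tau> k (NumLe i j) \<longleftrightarrow> numterm_over \<tau> k i \<and> numterm_over \<tau> k j"
| "fo_over \<tau> k (Neg p) \<longleftrightarrow> fo_over \<tau> k p"
| "fo_over \<tau> k (And p q) \<longleftrightarrow> fo_over \<tau> k p \<and> fo_over \<tau> k q"
| "fo_over \<tau> k (Or p q) \<longleftrightarrow> fo_over \<tau> k p \<and> fo_over \<tau> k q"
| "fo_over \<tau> k (Ex x p) \<longleftrightarrow> fo_over \<tau> k p"
| "fo_over \<tau> k (All x p) \<longleftrightarrow> fo_over \<tau> k p"

fun guard_vars :: "('r, 'c) guard \<Rightarrow> var set" where
  "guard_vars (GAtom l) = atom_vars l"
| "guard_vars (GNeg g) = guard_vars g"
| "guard_vars (GAnd g h) = guard_vars g \<union> guard_vars h"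
| "guard_vars (GOr g h) = guard_vars g \<union> guard_vars h"

fun numterm_free :: "('r, 'c) numterm \<Rightarrow> var set" where
  "numterm_free (App ys) = set ys"
| "numterm_free (Times i j) = numterm_free i \<union> numterm_free j"
| "numterm_free (Sum xs i g) = (numterm_free i \<union> guard_vars g) - set xs"

fun fo_free :: "('r, 'c) fo \<Rightarrow> var set" where
  "fo_free (Atom l) = atom_vars l"
| "fo_free (NumLe i j) = numterm_free i \<union> numterm_free j"
| "fo_free (Neg p) = fo_free p"
| "fo_free (And p q) = fo_free p \<union> fo_free q"
| "fo_free (Or p q) = fo_free p \<union> fo_free q"
| "fo_free (Ex x p) = fo_free p - {x}"
| "fo_free (All x p) = fo_free p - {x}"

definition fo_sentence :: "('r, 'c) vocabulary \<Rightarrow> nat \<Rightarrow> ('r, 'c) fo \<Rightarrow> bool" where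
  "fo_sentence \<tau> k p \<longleftrightarrow> fo_over \<tau> k p \<and> fo_free p = {}"

fun guard_sat :: "('r, 'c, 'a) struct \<Rightarrow> 'a assignment \<Rightarrow> ('r, 'c) guard \<Rightarrow> bool" where
  "guard_sat \<A> s (GAtom l) \<longleftrightarrow> atom_sat \<A> s l"
| "guard_sat \<A> s (GNeg g) \<longleftrightarrow> \<not> guard_sat \<A> s g"
| "guard_sat \<A> s (GAnd g h) \<longleftrightarrow> guard_sat \<A> s g \<and> guard_sat \<A> s h"
| "guard_sat \<A> s (GOr g h) \<longleftrightarrow> guard_sat \<A> s g \<or> guard_sat \<A> s h"

text \<open>The interpretation of the function symbol is a map \<open>f\<close> on lists of elements, of which
  only the values on \<open>k\<close>-tuples over the universe are relevant.\<close>

fun numterm_val ::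
  "('r, 'c, 'a) struct \<Rightarrow> ('a list \<Rightarrow> real) \<Rightarrow> 'a assignment \<Rightarrow> ('r, 'c) numterm \<Rightarrow> real"
where
  "numterm_val \<A> f s (App ys) = f (map (\<lambda>y. the (s y)) ys)"
| "numterm_val \<A> f s (Times i j) = numterm_val \<A> f s i * numterm_val \<A> f s j"
| "numterm_val \<A> f s (Sum xs i g) =
     (\<Sum>as | as \<in> tuples (universe \<A>) (length xs) \<and> guard_sat \<A> (s(xs [\<mapsto>] as)) g.
        numterm_val \<A> f (s(xs [\<mapsto>] as)) i)"

fun fo_sat ::
  "('r, 'c, 'a) struct \<Rightarrow> ('a list \<Rightarrow> real) \<Rightarrow> 'a assignment \<Rightarrow> ('r, 'c) fo \<Rightarrow> bool"
where
  "fo_sat \<A> f s (Atom l) \<longleftrightarrow> atom_sat \<A> s l"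
| "fo_sat \<A> f s (NumLe i j) \<longleftrightarrow> numterm_val \<A> f s i \<le> numterm_val \<A> f s j"
| "fo_sat \<A> f s (Neg p) \<longleftrightarrow> \<not> fo_sat \<A> f s p"
| "fo_sat \<A> f s (And p q) \<longleftrightarrow> fo_sat \<A> f s p \<and> fo_sat \<A> f s q"
| "fo_sat \<A> f s (Or p q) \<longleftrightarrow> fo_sat \<A> f s p \<or> fo_sat \<A> f s q"
| "fo_sat \<A> f s (Ex x p) \<longleftrightarrow> (\<exists>a\<in>universe \<A>. fo_sat \<A> f (s(x \<mapsto> a)) p)"
| "fo_sat \<A> f s (All x p) \<longleftrightarrow> (\<forall>a\<in>universe \<A>. fo_sat \<A> f (s(x \<mapsto> a)) p)"

definition fo_models ::
  "('r, 'c, 'a) struct \<Rightarrow> ('a list \<Rightarrow> real) \<Rightarrow> ('r, 'c) fo \<Rightarrow> bool" where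
  "fo_models \<A> f p \<longleftrightarrow> fo_sat \<A> f Map.empty p"

section \<open>The function given by a team\<close>

definition team_fun :: "var list \<Rightarrow> 'a team \<Rightarrow> 'a list \<Rightarrow> real" where
  "team_fun vs \<X> as = \<X> [vs [\<mapsto>] as]"

text \<open>For distinct \<open>vs\<close> this is, on tuples over the universe, the function \<open>f\<close> with \<open>f(s(v\<^sub>1), \<dots>, s(v\<^sub>k)) = \<X>(s)\<close> for
  every assignment \<open>s\<close>, and every tuple over the universe arises in this way from an
  assignment.\<close>

lemma map_upds_map_apply:
  "(m(vs [\<mapsto>] map g vs)) x = (if x \<in> set vs then Some (g x) else m x)"
  by (induction vs arbitrary: m) auto

lemma team_fun_apply:
  assumes "distinct vs" "s \<in> assignments \<A> (set vs)"
  shows "team_fun vs \<X> (map (\<lambda>v. the (s v)) vs) = \<X> s"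
proof -
  have "[vs [\<mapsto>] map (\<lambda>v. the (s v)) vs] = s"
  proof
    fix x
    have "x \<in> set vs \<longleftrightarrow> s x \<noteq> None"
      using assms(2) by (auto simp: assignments_def)
    then show "[vs [\<mapsto>] map (\<lambda>v. the (s v)) vs] x = s x"
      by (auto simp: map_upds_map_apply)
  qed
  then show ?thesis by (simp add: team_fun_def)
qed

lemma map_the_map_upds:
  assumes "length as = length vs" "distinct vs"
  shows "map (\<lambda>v. the ((m(vs [\<mapsto>] as)) v)) vs = as"
  using assms
proof (induction as vs arbitrary: m rule: list_induct2)
  case (Cons a as v vs)
  have "map (\<lambda>w. the ((m(v \<mapsto> a, vs [\<mapsto>] as)) w)) vs = as"
    using Cons.IH[of "m(v \<mapsto> a)"] Cons.prems by (simp only: distinct.simps)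
  moreover have "(m(v \<mapsto> a, vs [\<mapsto>] as)) v = Some a"
    using Cons.prems by simp
  ultimately show ?case by (simp only: map_upds_Cons list.map option.sel)
qed simp

lemma ran_map_upds_subset:
  assumes "length as = length vs"
  shows "ran (m(vs [\<mapsto>] as)) \<subseteq> ran m \<union> set as"
  using assms
proof (induction as vs arbitrary: m rule: list_induct2)
  case (Cons a as v vs)
  have "ran (m(v \<mapsto> a)) \<subseteq> insert a (ran m)"
    by (auto simp: ran_def)
  then show ?case
    using Cons.IH[of "m(v \<mapsto> a)"] by (simp only: map_upds_Cons list.set) blast
qed simp

lemma tuple_from_assignment:
  assumes "distinct vs" "as \<in> tuples (universe \<A>) (length vs)"
  shows "\<exists>s \<in> assignments \<A> (set vs). map (\<lambda>v. the (s v)) vs = as"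
proof
  show "[vs [\<mapsto>] as] \<in> assignments \<A> (set vs)"
    using assms ran_map_upds_subset[of as vs Map.empty]
    by (auto simp: assignments_def tuples_def)
  show "map (\<lambda>v. the ([vs [\<mapsto>] as] v)) vs = as"
    using assms by (intro map_the_map_upds) (auto simp: tuples_def)
qed

end

theory Submission
  imports Defs
begin

text \<open>Both sides of a conditional inequality are homogeneous of degree two in the team, so
  satisfaction of an FOPT formula does not change when the team is scaled by a positive constant.
  The sentence stating that \<open>f(v\<^sub>1, \<dots>, v\<^sub>k) \<le> f(v\<^sub>1, \<dots>, v\<^sub>k) \<times> f(v\<^sub>1, \<dots>, v\<^sub>k)\<close> for all
  \<open>v\<^sub>1, \<dots>, v\<^sub>k\<close> is not scale invariant: it holds for the constant function \<open>1\<close> but fails for the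
  constant function \<open>1/2\<close>.\<close>

lemma supp_scale:
  fixes c :: real
  assumes "c \<noteq> 0"
  shows "supp \<A> D (\<lambda>s. c * \<X> s) = supp \<A> D \<X>"
  using assms by (simp add: supp_def)

lemma weight_scale: "weight \<A> D (\<lambda>s. c * \<X> s) d = c * weight \<A> D \<X> d"
  by (simp add: weight_def sum_distrib_left)

lemma team_update_scale:
  "team_update \<A> D (\<lambda>s. c * \<X> s) a x = (\<lambda>s. c * team_update \<A> D \<X> a x s)"
  by (simp add: team_update_def sum_distrib_left)

text \<open>The common factor \<open>c^2\<close> cancels in conditional inequalities, and the
  unchanged support settles \<open>Flat\<close> and \<open>SNeg\<close>. Scaling commutes with
  \<open>team_update\<close>, but quantifiers change domain and team, so the induction generalises
  over both.\<close>

lemma fopt_sat_scale: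
  fixes c :: real
  assumes "c > 0"
  shows "fopt_sat \<A> D (\<lambda>s. c * \<X> s) p \<longleftrightarrow> fopt_sat \<A> D \<X> p"
proof (induction p arbitrary: D \<X>)
  case (CondLe d0 d1 d2 d3)
  have "(c * a) * (c * b) \<le> (c * a') * (c * b') \<longleftrightarrow> a * b \<le> a' * b'" for a b a' b' :: real
  proof -
    have "(c * a) * (c * b) = c^2 * (a * b)" "(c * a') * (c * b') = c^2 * (a' * b')"
      by (simp_all add: power2_eq_square)
    then show ?thesis
      using assms by simp
  qed
  then show ?case by (simp only: fopt_sat.simps weight_scale)
qed (use assms in \<open>simp_all add: supp_scale team_update_scale\<close>)

lemma fo_over_foldr_All: "fo_over \<tau> k (foldr All xs p) \<longleftrightarrow> fo_over \<tau> k p"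
  by (induction xs) auto

lemma fo_free_foldr_All: "fo_free (foldr All xs p) = fo_free p - set xs"
  by (induction xs) auto

text \<open>Over a nonempty universe, quantifiers in front of a body with constant truth value are
  vacuous. This evaluates the separating sentence at constant functions.\<close>

lemma fo_sat_foldr_All_cong:
  assumes "universe \<A> \<noteq> {}" and "\<And>s. fo_sat \<A> f s p \<longleftrightarrow> P"
  shows "fo_sat \<A> f s (foldr All xs p) \<longleftrightarrow> P"
  using assms by (induction xs arbitrary: s) auto

theorem theorem5:
  fixes \<tau> :: "('r, 'c) vocabulary" and k :: nat and vs :: "var list"
  assumes "finite_vocabulary \<tau>"
    and "distinct vs" and "length vs = k"
  shows "\<exists>\<psi> :: ('r, 'c) fo. fo_sentence \<tau> k \<psi> \<and>
    \<not> (\<exists>\<phi> :: ('r, 'c) fopt. fopt_over \<tau> \<phi> \<and> fopt_free \<phi> \<subseteq> set vs \<and>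
      (\<forall>\<A> :: ('r, 'c, nat) struct. finite_structure \<tau> \<A> \<longrightarrow>
        (\<forall>\<X>. prob_team \<A> (set vs) \<X> \<and> supp \<A> (set vs) \<X> \<noteq> {} \<longrightarrow>
          (fopt_sat \<A> (set vs) \<X> \<phi> \<longleftrightarrow> fo_models \<A> (team_fun vs \<X>) \<psi>))))"
proof -
  define \<psi> :: "('r, 'c) fo" where
    "\<psi> = foldr All vs (NumLe (App vs) (Times (App vs) (App vs)))"
  \<comment> \<open>A single element leaves exactly one assignment on \<open>set vs\<close> (the
    empty map if \<open>k = 0\<close>), so a team amounts to a single weight.\<close>
  define \<A> :: "('r, 'c, nat) struct" where
    "\<A> = \<lparr>universe = {0}, rel_interp = \<lambda>_. {}, const_interp = \<lambda>_. 0\<rparr>"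
  let ?D = "set vs"
  have fin: "finite_structure \<tau> \<A>"
    by (simp add: finite_structure_def \<A>_def)
  have "(\<lambda>x. if x \<in> ?D then Some 0 else None) \<in> assignments \<A> ?D"
    by (auto simp: assignments_def \<A>_def dom_def ran_def split: if_splits)
  then have supp: "supp \<A> ?D (\<lambda>_. c) \<noteq> {}" if "c > 0" for c
    using that by (auto simp: supp_def)
  have team: "prob_team \<A> ?D (\<lambda>_. c)" if "c > 0" for c
    using that by (simp add: prob_team_def)
  have "fo_sentence \<tau> k \<psi>"
    using assms by (simp add: fo_sentence_def \<psi>_def fo_over_foldr_All fo_free_foldr_All)
  moreover have models: "fo_models \<A> (team_fun vs (\<lambda>_. c)) \<psi> \<longleftrightarrow> c \<le> c * c" for c
    unfolding fo_models_def \<psi>_def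
    by (rule fo_sat_foldr_All_cong) (simp_all add: team_fun_def \<A>_def)
  have False
    if agree: "\<forall>\<A> :: ('r, 'c, nat) struct. finite_structure \<tau> \<A> \<longrightarrow>
      (\<forall>\<X>. prob_team \<A> ?D \<X> \<and> supp \<A> ?D \<X> \<noteq> {} \<longrightarrow>
        (fopt_sat \<A> ?D \<X> \<phi> \<longleftrightarrow> fo_models \<A> (team_fun vs \<X>) \<psi>))" for \<phi>
  proof -
    have iff: "fopt_sat \<A> ?D (\<lambda>_. c) \<phi> \<longleftrightarrow> c \<le> c * c" if "c > 0" for c
      using agree fin supp[OF that] team[OF that] models by blast
    \<comment> \<open>Scaling identifies the weights 1/2 and 1, whereas \<open>c \<le> c * c\<close>
      separates them: 1/2 > 1/4, but 1 = 1 * 1.\<close>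
    have "fopt_sat \<A> ?D (\<lambda>_. 1/2) \<phi> \<longleftrightarrow> fopt_sat \<A> ?D (\<lambda>_. 1) \<phi>"
      using fopt_sat_scale[of "1/2" \<A> ?D "\<lambda>_. 1" \<phi>] by simp
    then show False
      using iff[of "1/2"] iff[of 1] by simp
  qed
  ultimately show ?thesis by blast
qed

end
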